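(* Let $q$ be an odd prime power and $m>1$ an integer with $m\mid\frac{q+1}{2}$. Define $\varphi:\mathbb{F}_{q^2}\to\mathbb{F}_{q^2}$ by $\varphi(\gamma)=\frac{\gamma+1}{\gamma-1}$ for $\gamma\neq1$ and $\varphi(1)=1$. Then $\varphi(\{0\}\cup Q_0)$ (where $\{0\}\cup Q_0$ is a clique of $\mathrm{GP}(q^2,m)$) equals the clique $\{\pm1,c_1\alpha,\dots,c_{\frac{q+1-m}{m}}\alpha\}$ of size $\frac{q+1+m}{m}$, where $c_1\alpha,\dots,c_{\frac{q+1-m}{m}}\alpha$ are the points where the line $\alpha\mathbb{F}_q=\{c\alpha:c\in\mathbb{F}_q\}$ meets the $m$-ary lines through $1$ other than the line $\{1+c\alpha:c\in\mathbb{F}_q\}$.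
   Context: The generalised Paley graph $\mathrm{GP}(q^2,m)$ has vertex set $\mathbb{F}_{q^2}$, with two distinct vertices $x,y$ adjacent iff $x-y$ is an $m$-th power of an element of $\mathbb{F}_{q^2}^*$. Fix a non-square $d\in\mathbb{F}_q^*$ and $\alpha\in\mathbb{F}_{q^2}$ with $\alpha^2=d$, so $\mathbb{F}_{q^2}=\{x+y\alpha:x,y\in\mathbb{F}_q\}$ is viewed as the affine plane $AG(2,q)$. A line is a set $\{a+cs:c\in\mathbb{F}_q\}$ with $a\in\mathbb{F}_{q^2}$, $s\in\mathbb{F}_{q^2}^*$; it is $m$-ary if its slope $s$ is an $m$-th power in $\mathbb{F}_{q^2}^*$. Fix a primitive element $\beta$ of $\mathbb{F}_{q^2}$, let $\omega=\beta^{q-1}$ and $Q_0=\langle\omega^m\rangle$. *)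

theory Defs
  imports "HOL-Library.Ramsey" "HOL-Number_Theory.Prime_Powers"
begin

text \<open>
  The ambient field of order \<open>q\<^sup>2\<close> is a type of class \<open>finite_field\<close>; its subfield of
  order \<open>q\<close> is a subset \<open>K\<close> of that type.
\<close>

definition is_subfield :: "'a::field set \<Rightarrow> bool" where
  "is_subfield K \<longleftrightarrow> 0 \<in> K \<and> 1 \<in> K \<and>
     (\<forall>x\<in>K. \<forall>y\<in>K. x + y \<in> K \<and> x * y \<in> K) \<and>
     (\<forall>x\<in>K. - x \<in> K \<and> inverse x \<in> K)"

definition primitive_element :: "'a::field \<Rightarrow> bool" where
  "primitive_element b \<longleftrightarrow> range (\<lambda>k::nat. b ^ k) = UNIV - {0}"

definition unit_power :: "nat \<Rightarrow> 'a::field \<Rightarrow> bool" where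
  "unit_power m x \<longleftrightarrow> (\<exists>y. y \<noteq> 0 \<and> x = y ^ m)"

text \<open>
  Edges are unordered pairs, as the library's \<open>clique\<close> expects. That this is the intended
  graph, i.e. that membership of \<open>x - y\<close> in the \<open>m\<close>-th powers is symmetric in \<open>x\<close> and \<open>y\<close>,
  is shown below in \<open>GP_edge_iff\<close>.
\<close>

definition GP_edges :: "nat \<Rightarrow> 'a::field set set" where
  "GP_edges m = {{x, y} | x y. x \<noteq> y \<and> unit_power m (x - y)}"

definition line :: "'a::field set \<Rightarrow> 'a \<Rightarrow> 'a \<Rightarrow> 'a set" where
  "line K a s = {a + c * s | c. c \<in> K}"

text \<open>
  A line determines its slope only up to a factor in \<open>K - {0}\<close>. When \<open>card K = q\<close> and
  \<open>m\<close> divides \<open>q + 1\<close>, all these factors are \<open>m\<close>-th powers in the field of order \<open>q\<^sup>2\<close>, so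
  it does not matter which slope is tested.
\<close>

definition m_ary_line :: "'a::field set \<Rightarrow> nat \<Rightarrow> 'a set \<Rightarrow> bool" where
  "m_ary_line K m L \<longleftrightarrow> (\<exists>a s. s \<noteq> 0 \<and> L = line K a s \<and> unit_power m s)"

definition Q0 :: "nat \<Rightarrow> nat \<Rightarrow> 'a::field \<Rightarrow> 'a set" where
  "Q0 q m \<beta> = range (\<lambda>k::int. ((\<beta> ^ (q - 1)) ^ m) powi k)"

definition phi :: "'a::field \<Rightarrow> 'a" where
  "phi \<gamma> = (if \<gamma> = 1 then 1 else (\<gamma> + 1) / (\<gamma> - 1))"

lemma GP_edge_iff_if_minus_one:
  assumes "unit_power m (- 1 :: 'a::field)"
  shows "{x, y} \<in> GP_edges m \<longleftrightarrow> x \<noteq> y \<and> unit_power m (x - y :: 'a)"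
proof -
  have sym: "unit_power m (u - v)" if v: "unit_power m (v - u)" for u v :: 'a
  proof -
    from assms v obtain a b :: 'a where "a \<noteq> 0" "- 1 = a ^ m" "b \<noteq> 0" "v - u = b ^ m"
      unfolding unit_power_def by blast
    have "u - v = - 1 * (v - u)" by simp
    also have "\<dots> = (a * b) ^ m"
      by (simp only: \<open>- 1 = a ^ m\<close> \<open>v - u = b ^ m\<close> power_mult_distrib)
    finally have "u - v = (a * b) ^ m" .
    moreover have "a * b \<noteq> 0" using \<open>a \<noteq> 0\<close> \<open>b \<noteq> 0\<close> by simp
    ultimately show ?thesis unfolding unit_power_def by blast
  qed
  show ?thesis unfolding GP_edges_def by (auto simp: doubleton_eq_iff intro: sym)
qed

lemma unit_power_minus_one:
  fixes \<beta> :: "'a::finite_field"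
  assumes card: "card (UNIV :: 'a set) = q ^ 2" and q: "odd q" "q > 1" and m: "m dvd (q + 1) div 2"
    and prim: "primitive_element \<beta>"
  shows "unit_power m (- 1 :: 'a)"
proof -
  have rng: "range (\<lambda>k::nat. \<beta> ^ k) = UNIV - {0}"
    using prim by (simp add: primitive_element_def)
  have nz: "\<beta> \<noteq> 0"
    using rng by (metis DiffE power_one_right rangeI singletonI)
  obtain r where r: "q = 2 * r + 1" using q by (auto elim: oddE)
  have r0: "r > 0" using q r by simp
  define M where "M = q ^ 2 - 1"
  define h where "h = (q - 1) * ((q + 1) div 2)"
  have Mh: "M = 2 * h" by (simp add: M_def h_def r power2_eq_square algebra_simps)
  have h0: "h > 0" using r0 by (simp add: h_def r)
  have cU: "card (UNIV - {0::'a}) = M" by (simp add: card_Diff_singleton card M_def)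
  have per: "M \<le> n" if "n > 0" "\<beta> ^ n = 1" for n
  proof -
    have "\<beta> ^ k = \<beta> ^ (k mod n)" for k
      by (metis that(2) div_mult_mod_eq mult.left_neutral power_add power_mult power_one mult.commute)
    hence "range (\<lambda>k::nat. \<beta> ^ k) \<subseteq> (\<lambda>k. \<beta> ^ k) ` {..<n}"
      using that(1) by (force intro: image_eqI)
    hence "M \<le> card ((\<lambda>k. \<beta> ^ k) ` {..<n})"
      unfolding rng cU[symmetric] by (intro card_mono) auto
    also have "\<dots> \<le> n" using card_image_le[of "{..<n}"] by simp
    finally show ?thesis .
  qed
  have "q ^ 2 = Suc M" using q by (simp add: M_def)
  hence "\<beta> * \<beta> ^ M = \<beta>"
    using finite_field_power_card_eq_same[of \<beta>] card by simp
  hence "\<beta> ^ M = 1" using nz by simp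
  hence "(\<beta> ^ h) ^ 2 = 1" by (simp add: Mh power_mult[symmetric] mult.commute)
  moreover have "\<beta> ^ h \<noteq> 1" using per[of h] h0 Mh by auto
  ultimately have "\<beta> ^ h = - 1" by (simp add: power2_eq_1_iff)
  moreover obtain t where "h = t * m" using m unfolding h_def by (metis dvd_def dvd_mult mult.commute)
  ultimately have "- 1 = (\<beta> ^ t) ^ m" by (simp add: power_mult)
  thus ?thesis unfolding unit_power_def using nz by (intro exI[of _ "\<beta> ^ t"]) auto
qed

lemma GP_edge_iff:
  fixes \<beta> x y :: "'a::finite_field"
  assumes "card (UNIV :: 'a set) = q ^ 2" "odd q" "q > 1" "m dvd (q + 1) div 2" "primitive_element \<beta>"
  shows "{x, y} \<in> GP_edges m \<longleftrightarrow> x \<noteq> y \<and> unit_power m (x - y)"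
  using GP_edge_iff_if_minus_one[OF unit_power_minus_one[OF assms]] .

end

theory Submission
  imports Defs "HOL-Number_Theory.Residues"
begin

text \<open>
  Everything is expressed through powers: with \<open>q + 1 = m n\<close>, the subfield is cut out by
  \<open>x\<^sup>q = x\<close>, the group \<open>Q\<^sub>0\<close> by \<open>x\<^sup>n = 1\<close>, the line \<open>\<alpha>K\<close> by \<open>z\<^sup>q = - z\<close>, and a nonzero \<open>x\<close> is an
  \<open>m\<close>-th power iff \<open>x\<^bsup>q - 1\<^esup> \<in> Q\<^sub>0\<close>. As \<open>x \<mapsto> x\<^sup>q\<close> is a field automorphism inverting \<open>Q\<^sub>0\<close>, it
  sends \<open>\<phi>(u)\<close> to \<open>- \<phi>(u)\<close> for \<open>u \<in> Q\<^sub>0 - {1}\<close>, so \<open>\<phi>(u) \<in> \<alpha>K\<close>; conversely, for \<open>z \<in> \<alpha>K\<close> one has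
  \<open>\<phi>(z) = - (z - 1)\<^bsup>q - 1\<^esup>\<close>, which lies in \<open>Q\<^sub>0\<close> iff the line through \<open>1\<close> and \<open>z\<close> is \<open>m\<close>-ary.
  Since \<open>\<phi>\<close> is an involution and \<open>\<phi>(x) - \<phi>(y) = 2 (y - x) / ((x - 1) (y - 1))\<close>, it maps every
  clique containing \<open>1\<close> to a clique.
\<close>

section \<open>Powers of a primitive element and roots of unity\<close>

lemma primitive_element_nonzero:
  assumes "primitive_element (\<beta> :: 'a::field)"
  shows "\<beta> \<noteq> 0"
  using assms unfolding primitive_element_def by (metis DiffE power_one_right rangeI singletonI)

lemma power_mod_period:
  assumes "(x :: 'a::monoid_mult) ^ n = 1"
  shows "x ^ (k mod n) = x ^ k"
proof -
  have "x ^ k = (x ^ n) ^ (k div n) * x ^ (k mod n)"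
    by (simp flip: power_mult power_add)
  thus ?thesis using assms by simp
qed

text \<open>If \<open>\<beta> ^ n = 1\<close> with \<open>n > 0\<close>, there are at most
  \<open>n\<close> distinct powers, yet they must exhaust the nonzero elements; so the order of
  \<open>\<beta>\<close> is exactly their number.\<close>

lemma primitive_element_power_eq_1_iff:
  fixes \<beta> :: "'a::finite_field"
  assumes "primitive_element \<beta>"
  shows "\<beta> ^ j = 1 \<longleftrightarrow> (card (UNIV :: 'a set) - 1) dvd j"
proof -
  define N where "N = card (UNIV :: 'a set) - 1"
  have rng: "range (\<lambda>k::nat. \<beta> ^ k) = UNIV - {0}"
    using assms by (simp add: primitive_element_def)
  have nz: "\<beta> \<noteq> 0" using assms by (rule primitive_element_nonzero)
  have card: "card (UNIV :: 'a set) = Suc N"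
    by (simp add: N_def card_gt_0_iff)
  have min: "N \<le> n" if "n > 0" "\<beta> ^ n = 1" for n
  proof -
    have "range (\<lambda>k::nat. \<beta> ^ k) \<subseteq> (\<lambda>k. \<beta> ^ k) ` {..<n}"
      using that(1) power_mod_period[OF that(2), symmetric] by (force intro: image_eqI)
    hence "card (UNIV - {0::'a}) \<le> card ((\<lambda>k. \<beta> ^ k) ` {..<n})"
      unfolding rng by (intro card_mono) auto
    also have "\<dots> \<le> n" using card_image_le[of "{..<n}"] by simp
    finally show ?thesis by (simp add: card_Diff_singleton card)
  qed
  have "\<beta> * \<beta> ^ N = \<beta>"
    using finite_field_power_card_eq_same[of \<beta>] card by simp
  hence 1: "\<beta> ^ N = 1" using nz by simp
  have "N > 0"
    using card card_mono[of UNIV "{0, 1 :: 'a}"] by simp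
  have "N dvd j" if "\<beta> ^ j = 1"
  proof -
    have "\<beta> ^ (j mod N) = 1" using power_mod_period[OF 1, of j] that by simp
    moreover have "j mod N < N" using \<open>N > 0\<close> by simp
    ultimately have "j mod N = 0" using min[of "j mod N"] by linarith
    thus ?thesis by presburger
  qed
  moreover have "\<beta> ^ j = 1" if "N dvd j"
    using that 1 by (auto simp: dvd_def power_mult)
  ultimately show ?thesis unfolding N_def by blast
qed

text \<open>In a cyclic group of order \<open>a * b\<close>, the elements killed by \<open>b\<close>
  form the subgroup generated by the \<open>a\<close>-th power of a generator. Different
  factorisations of \<open>q ^ 2 - 1\<close> yield \<open>K - {0}\<close>, \<open>Q0\<close> and the
  \<open>m\<close>-th powers.\<close>

lemma root_of_unity_iff:
  fixes \<beta> x :: "'a::finite_field"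
  assumes \<beta>: "primitive_element \<beta>" and ab: "a * b = card (UNIV :: 'a set) - 1" and "b > 0"
  shows "x ^ b = 1 \<longleftrightarrow> (\<exists>k. x = (\<beta> ^ a) ^ k)"
proof
  assume x: "x ^ b = 1"
  hence "x \<noteq> 0" using \<open>b > 0\<close> by (auto simp: zero_power)
  then obtain j where j: "x = \<beta> ^ j"
    using \<beta> unfolding primitive_element_def by blast
  have "\<beta> ^ (j * b) = 1" using x j by (simp add: power_mult)
  hence "a * b dvd j * b" using primitive_element_power_eq_1_iff[OF \<beta>] ab by simp
  hence "a dvd j" using \<open>b > 0\<close> by simp
  thus "\<exists>k. x = (\<beta> ^ a) ^ k" using j by (auto simp: dvd_def power_mult)
next
  assume "\<exists>k. x = (\<beta> ^ a) ^ k"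
  then obtain k where "x = (\<beta> ^ a) ^ k" ..
  hence "x ^ b = \<beta> ^ ((a * b) * k)" by (simp flip: power_mult add: ac_simps)
  thus "x ^ b = 1" using primitive_element_power_eq_1_iff[OF \<beta>] ab by simp
qed

lemma card_roots_of_unity:
  fixes \<beta> :: "'a::finite_field"
  assumes \<beta>: "primitive_element \<beta>" and ab: "a * b = card (UNIV :: 'a set) - 1" and "a > 0" "b > 0"
  shows "card {x :: 'a. x ^ b = 1} = b"
proof -
  let ?g = "\<beta> ^ a"
  have gb: "?g ^ b = 1" using root_of_unity_iff[OF \<beta> ab \<open>b > 0\<close>, of ?g] by (metis power_one_right)
  have nz: "\<beta> \<noteq> 0" using \<beta> by (rule primitive_element_nonzero)
  have le: "j = i" if "i \<le> j" "j < b" "?g ^ i = ?g ^ j" for i j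
  proof -
    have "?g ^ j = ?g ^ i * ?g ^ (j - i)"
      using power_add[of ?g i "j - i"] that(1) by simp
    hence "?g ^ (j - i) = 1" using nz that(3) by simp
    hence "a * b dvd a * (j - i)"
      using primitive_element_power_eq_1_iff[OF \<beta>, of "a * (j - i)"] ab by (simp add: power_mult)
    hence "b dvd j - i" using \<open>a > 0\<close> by simp
    moreover have "j - i < b" using that(2) by simp
    ultimately show ?thesis using that(1) by (metis dvd_imp_le le_antisym diff_is_0_eq not_le zero_less_iff_neq_zero)
  qed
  have inj: "inj_on (\<lambda>k. ?g ^ k) {..<b}"
  proof (rule inj_onI)
    fix i j assume "i \<in> {..<b}" "j \<in> {..<b}" "?g ^ i = ?g ^ j"
    thus "i = j" using le[of i j] le[of j i] by (metis lessThan_iff linear)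
  qed
  have "{x. x ^ b = 1} = (\<lambda>k. ?g ^ k) ` {..<b}"
    unfolding root_of_unity_iff[OF \<beta> ab \<open>b > 0\<close>]
    using power_mod_period[OF gb, symmetric] \<open>b > 0\<close>
    by (auto intro!: image_eqI[where x = "_ mod b"])
  thus ?thesis using card_image[OF inj] by simp
qed

text \<open>Multiplication by \<open>x\<close> permutes \<open>K - {0}\<close>, so it leaves the
  product of all its elements unchanged.\<close>

lemma subfield_power_card:
  fixes K :: "'a::finite_field set"
  assumes "is_subfield K" "x \<in> K" "x \<noteq> 0"
  shows "x ^ (card K - 1) = 1"
proof -
  let ?U = "K - {0}"
  have 0: "0 \<in> K" using assms by (simp add: is_subfield_def)
  have "bij_betw (\<lambda>y. x * y) ?U ?U"
  proof (rule bij_betwI[where g = "\<lambda>y. inverse x * y"])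
    show "(\<lambda>y. x * y) \<in> ?U \<rightarrow> ?U" "(\<lambda>y. inverse x * y) \<in> ?U \<rightarrow> ?U"
      using assms by (auto simp: is_subfield_def)
  qed (use assms in auto)
  hence "(\<Prod>y\<in>?U. x * y) = (\<Prod>y\<in>?U. y)" by (rule prod.reindex_bij_betw)
  hence "x ^ card ?U * \<Prod>?U = \<Prod>?U" by (simp add: prod.distrib)
  moreover have "\<Prod>?U \<noteq> 0" by simp
  ultimately show ?thesis using 0 by (simp add: card_Diff_singleton)
qed

section \<open>Closure of \<open>m\<close>-th powers and identities for \<open>phi\<close>\<close>

lemma unit_power_mult:
  "unit_power m x \<Longrightarrow> unit_power m y \<Longrightarrow> unit_power m (x * y)"
  unfolding unit_power_def by (metis no_zero_divisors power_mult_distrib)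

lemma unit_power_inverse:
  "unit_power m x \<Longrightarrow> unit_power m (inverse x)"
  unfolding unit_power_def by (metis nonzero_imp_inverse_nonzero power_inverse)

lemma unit_power_divide:
  "unit_power m x \<Longrightarrow> unit_power m y \<Longrightarrow> unit_power m (x / y)"
  by (simp add: divide_inverse unit_power_mult unit_power_inverse)

text \<open>The matrix of this Moebius map squares to \<open>2\<close> times the identity. As
  \<open>2 \<noteq> 0\<close>, no \<open>x \<noteq> 1\<close> is sent to \<open>1\<close>, so the
  convention \<open>phi 1 = 1\<close> keeps \<open>phi\<close> an involution.\<close>

lemma phi_involution:
  assumes "(2::'a::field) \<noteq> 0"
  shows "phi (phi (x::'a)) = x"
proof (cases "x = 1")
  case False
  have "(x + 1) / (x - 1) - 1 = 2 / (x - 1)" "(x + 1) / (x - 1) + 1 = 2 * x / (x - 1)"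
    using False by (simp_all add: field_simps)
  moreover have "2 / (x - 1) \<noteq> 0" using assms False by simp
  ultimately show ?thesis using False assms by (auto simp: phi_def)
qed (simp add: phi_def)

lemma phi_diff_one:
  "x \<noteq> 1 \<Longrightarrow> phi x - 1 = 2 / (x - 1)"
  by (simp add: phi_def field_simps)

lemma phi_diff:
  assumes "x \<noteq> 1" "y \<noteq> 1"
  shows "phi x - phi y = 2 * (y - x) / ((x - 1) * (y - 1))"
  using assms by (simp add: phi_def divide_simps) (simp add: algebra_simps)

text \<open>The number \<open>n\<close> will be the order of \<open>Q0\<close>. Its evenness encodes
  \<open>m dvd (q + 1) div 2\<close> and puts \<open>- 1\<close> into \<open>Q0\<close>;
  \<open>\<alpha> \<notin> K\<close> stands for \<open>d\<close> being a non-square in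
  \<open>K\<close>.\<close>

locale odd_quadratic_extension =
  fixes q m n :: nat and K :: "'a::finite_field set" and \<alpha> \<beta> :: 'a
  assumes q_primepow: "primepow q" and q_odd: "odd q"
    and m_pos: "m > 0" and q_eq: "q + 1 = m * n" and n_even: "even n"
    and card_field: "card (UNIV :: 'a set) = q ^ 2"
    and K_subfield: "is_subfield K" and card_K: "card K = q"
    and \<alpha>_sq: "\<alpha> ^ 2 \<in> K" and \<alpha>_notin: "\<alpha> \<notin> K"
    and \<beta>_primitive: "primitive_element \<beta>"
begin

section \<open>The subfield, \<open>Q0\<close> and the \<open>m\<close>-th powers as conditions on
  powers\<close>

lemma q_gt_2: "q > 2"
  using q_primepow q_odd primepow_gt_Suc_0[of q] by (cases "q = 2") auto

lemma n_pos: "n > 0"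
  using q_eq by (cases n) auto

lemma card_units: "(q - 1) * (m * n) = card (UNIV :: 'a set) - 1"
  using q_gt_2 by (simp add: card_field q_eq[symmetric] power2_eq_square algebra_simps)

lemma prime_CHAR: "prime CHAR('a)"
  by (intro prime_CHAR_semidom finite_imp_CHAR_pos) simp

text \<open>The characteristic divides the order of the field, a power of the prime under
  \<open>q\<close>. This makes \<open>x \<mapsto> x ^ q\<close> additive.\<close>

lemma ex_q_eq_CHAR_power: "\<exists>k. q = CHAR('a) ^ k"
proof -
  obtain p k where pk: "prime p" "q = p ^ k" using q_primepow unfolding primepow_def by blast
  have "CHAR('a) dvd p ^ (k * 2)"
    using CHAR_dvd_CARD[where ?'a = 'a] by (simp add: card_field pk power_mult)
  hence "CHAR('a) dvd p" using prime_CHAR prime_dvd_power by blast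
  hence "CHAR('a) = p" using prime_CHAR pk(1) by (metis primes_dvd_imp_eq)
  thus ?thesis using pk by blast
qed

lemma power_add_q: "(x + y :: 'a) ^ q = x ^ q + y ^ q"
  using freshmans_dream'[OF prime_CHAR] ex_q_eq_CHAR_power by blast

text \<open>The nonzero elements of \<open>K\<close> are \<open>(q - 1)\<close>-th roots of unity,
  and there are exactly \<open>q - 1\<close> of either.\<close>

lemma mem_K_iff: "x \<in> K \<longleftrightarrow> x ^ q = x"
proof -
  have q: "x ^ q = x * x ^ (q - 1)" for x :: 'a
    using q_gt_2 by (simp flip: power_Suc)
  let ?R = "{x :: 'a. x ^ (q - 1) = 1}"
  have "K - {0} \<subseteq> ?R" using subfield_power_card[OF K_subfield] card_K by auto
  moreover have "card ?R = card (K - {0})"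
    using card_roots_of_unity[OF \<beta>_primitive, of "m * n" "q - 1"] card_units q_gt_2 m_pos n_pos
      K_subfield card_K by (simp add: mult.commute card_Diff_singleton is_subfield_def)
  ultimately have "K - {0} = ?R" by (intro card_subset_eq) auto
  moreover have "0 \<in> K" using K_subfield by (simp add: is_subfield_def)
  ultimately show ?thesis using q[of x] by (cases "x = 0") auto
qed

lemma Q0_eq: "Q0 q m \<beta> = {x. x ^ n = 1}"
proof -
  let ?g = "\<beta> ^ ((q - 1) * m)"
  have iff: "x ^ n = 1 \<longleftrightarrow> (\<exists>k. x = ?g ^ k)" for x
    using root_of_unity_iff[OF \<beta>_primitive _ n_pos] card_units by (metis mult.assoc)
  have "?g ^ n = 1" using iff[of ?g] by (metis power_one_right)
  hence "(?g powi k) ^ n = 1" for k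
    by (metis power_int_of_nat power_int_power' power_int_mult mult.commute power_int_1_left)
  moreover have "x \<in> range (\<lambda>k::int. ?g powi k)" if "x ^ n = 1" for x
    using that unfolding iff by (metis power_int_of_nat rangeI)
  ultimately have "range (\<lambda>k::int. ?g powi k) = {x. x ^ n = 1}" by auto
  thus ?thesis by (simp only: Q0_def flip: power_mult)
qed

lemma card_Q0: "card (Q0 q m \<beta>) = n"
  using card_roots_of_unity[OF \<beta>_primitive, of "(q - 1) * m" n] card_units q_gt_2 m_pos n_pos
  by (simp add: Q0_eq mult.assoc)

text \<open>The \<open>m\<close>-th powers form the subgroup generated by
  \<open>\<beta> ^ m\<close>, of order \<open>(q - 1) * n\<close>; splitting this exponent gives the
  test. Zero fails both sides.\<close>

lemma unit_power_iff_Q0: "unit_power m x \<longleftrightarrow> x ^ (q - 1) \<in> Q0 q m \<beta>"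
proof -
  have pos: "(q - 1) * n > 0" using q_gt_2 n_pos by simp
  have "unit_power m x \<longleftrightarrow> (\<exists>k. x = (\<beta> ^ m) ^ k)"
  proof
    assume "unit_power m x"
    then obtain y where "y \<noteq> 0" "x = y ^ m" unfolding unit_power_def by blast
    moreover from \<open>y \<noteq> 0\<close> obtain k where "y = \<beta> ^ k"
      using \<beta>_primitive unfolding primitive_element_def by blast
    ultimately have "x = (\<beta> ^ m) ^ k" by (simp add: mult.commute flip: power_mult)
    thus "\<exists>k. x = (\<beta> ^ m) ^ k" ..
  next
    assume "\<exists>k. x = (\<beta> ^ m) ^ k"
    then obtain k where "x = (\<beta> ^ k) ^ m" by (auto simp: mult.commute simp flip: power_mult)
    thus "unit_power m x"
      using primitive_element_nonzero[OF \<beta>_primitive] unfolding unit_power_def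
      by (intro exI[of _ "\<beta> ^ k"]) auto
  qed
  also have "\<dots> \<longleftrightarrow> x ^ ((q - 1) * n) = 1"
    using root_of_unity_iff[OF \<beta>_primitive _ pos, of m] card_units by (simp add: ac_simps)
  also have "\<dots> \<longleftrightarrow> x ^ (q - 1) \<in> Q0 q m \<beta>" by (simp add: Q0_eq power_mult)
  finally show ?thesis .
qed

text \<open>The exponent has the form to which the simplifier brings \<open>q - 1\<close>.\<close>

lemma power_q_minus_1: "x \<noteq> 0 \<Longrightarrow> x ^ (q - Suc 0) = x ^ q / (x::'a)"
  using q_gt_2 by (simp add: power_diff)

lemma uminus_Q0_iff [simp]: "- x \<in> Q0 q m \<beta> \<longleftrightarrow> x \<in> Q0 q m \<beta>"
  using n_even by (simp add: Q0_eq)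

lemma inverse_Q0_iff [simp]: "inverse x \<in> Q0 q m \<beta> \<longleftrightarrow> x \<in> Q0 q m \<beta>"
  by (simp add: Q0_eq power_inverse)

lemma one_in_Q0 [simp]: "1 \<in> Q0 q m \<beta>"
  by (simp add: Q0_eq)

lemma zero_notin_Q0 [simp]: "0 \<notin> Q0 q m \<beta>"
  using n_pos by (simp add: Q0_eq zero_power)

text \<open>Since \<open>n\<close> divides \<open>q + 1\<close>, elements of \<open>Q0\<close>
  satisfy \<open>u ^ (q + 1) = 1\<close>.\<close>

lemma Q0_power_q:
  assumes "u \<in> Q0 q m \<beta>"
  shows "u ^ q = inverse u"
proof -
  have "u * u ^ q = u ^ (m * n)" by (simp flip: q_eq)
  also have "\<dots> = 1" using assms by (simp add: Q0_eq mult.commute[of m] power_mult)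
  finally show ?thesis by (metis inverse_unique)
qed

lemma unit_power_K:
  assumes "x \<in> K" "x \<noteq> 0"
  shows "unit_power m x"
  using assms by (simp add: unit_power_iff_Q0 power_q_minus_1 mem_K_iff)

lemma unit_power_Q0:
  assumes "u \<in> Q0 q m \<beta>"
  shows "unit_power m u"
proof -
  have "u ^ (q - 1) = (inverse u) ^ 2"
    using assms by (cases "u = 0") (simp_all add: power_q_minus_1 Q0_power_q power2_eq_square divide_inverse)
  thus ?thesis using assms by (simp add: unit_power_iff_Q0 Q0_eq power_inverse mult.commute flip: power_mult)
       (simp add: power_mult)
qed

text \<open>Raising to the power \<open>q\<close> turns \<open>u - 1\<close> into
  \<open>inverse u - 1 = - (u - 1) / u\<close>, so the \<open>(q - 1)\<close>-th power is
  \<open>- inverse u\<close>, an element of \<open>Q0\<close>.\<close>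

lemma unit_power_Q0_diff_one:
  assumes "u \<in> Q0 q m \<beta>" "u \<noteq> 1"
  shows "unit_power m (u - 1)"
proof -
  have u: "u \<noteq> 0" using assms by auto
  have "(u - 1) ^ q = inverse u - 1"
    using power_add_q[of u "- 1"] assms q_odd by (simp add: Q0_power_q)
  hence "(u - 1) ^ (q - 1) = - inverse u"
    using assms u by (simp add: power_q_minus_1 divide_simps)
  thus ?thesis using assms by (simp add: unit_power_iff_Q0)
qed

lemma unit_power_uminus_iff [simp]: "unit_power m (- x :: 'a) \<longleftrightarrow> unit_power m x"
  using q_odd q_gt_2 by (simp add: unit_power_iff_Q0)

section \<open>Cliques and their images under \<open>phi\<close>\<close>

lemma clique_iff:
  "clique (V :: 'a set) (GP_edges m) \<longleftrightarrow> (\<forall>x\<in>V. \<forall>y\<in>V. x \<noteq> y \<longrightarrow> unit_power m (x - y))"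
proof -
  have "unit_power m (- 1 :: 'a)" using unit_power_Q0[of 1] by simp
  thus ?thesis by (auto simp: clique_def GP_edge_iff_if_minus_one)
qed

lemma unit_power_diff_commute: "unit_power m (x - y :: 'a) \<longleftrightarrow> unit_power m (y - x)"
  using unit_power_uminus_iff[of "x - y"] by simp

text \<open>\<open>Q0\<close> is a group of \<open>m\<close>-th powers, so factoring
  \<open>v\<close> out of \<open>u - v\<close> reduces the claim to
  \<open>u / v - 1\<close>.\<close>

lemma clique_Q0: "clique ({0} \<union> Q0 q m \<beta>) (GP_edges m)"
proof -
  have "unit_power m (u - v)" if u: "u \<in> Q0 q m \<beta>" and v: "v \<in> Q0 q m \<beta>" and "u \<noteq> v" for u v
  proof -
    have "v \<noteq> 0" using v by auto
    hence "u - v = v * (u / v - 1)" "u / v \<noteq> 1" using \<open>u \<noteq> v\<close> by (simp_all add: field_simps)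
    moreover have "u / v \<in> Q0 q m \<beta>" using u v by (simp add: Q0_eq power_divide)
    ultimately show ?thesis
      using unit_power_mult[OF unit_power_Q0[OF v] unit_power_Q0_diff_one] by metis
  qed
  thus ?thesis using unit_power_Q0 by (auto simp: clique_iff)
qed

lemma two_nonzero: "(2::'a) \<noteq> 0"
proof
  assume "(2::'a) = 0"
  hence "CHAR('a) dvd 2" using of_nat_eq_0_iff_char_dvd[of 2, where ?'a = 'a] by simp
  hence "CHAR('a) = 2" using prime_CHAR by (metis primes_dvd_imp_eq two_is_prime_nat)
  moreover obtain k where "q = CHAR('a) ^ k" using ex_q_eq_CHAR_power ..
  ultimately show False using q_odd q_gt_2 by (cases "k = 0") auto
qed

lemma unit_power_2: "unit_power m (2 :: 'a)"
proof -
  have "1 + 1 \<in> K" using K_subfield unfolding is_subfield_def by blast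
  thus ?thesis using two_nonzero by (intro unit_power_K) simp_all
qed

text \<open>Having \<open>1 \<in> V\<close> makes the denominators \<open>x - 1\<close> and
  \<open>y - 1\<close> of the difference formulas \<open>m\<close>-th powers; the factor
  \<open>2\<close> is one because it lies in \<open>K\<close>.\<close>

lemma clique_phi_image:
  assumes "clique (V :: 'a set) (GP_edges m)" "1 \<in> V"
  shows "clique (phi ` V) (GP_edges m)"
proof -
  have V: "unit_power m (x - y)" if "x \<in> V" "y \<in> V" "x \<noteq> y" for x y
    using that assms by (auto simp: clique_iff)
  have 1: "unit_power m (phi x - 1)" if "x \<in> V" "x \<noteq> 1" for x
    unfolding phi_diff_one[OF that(2)]
    using that assms by (intro unit_power_divide unit_power_2 V) auto
  have 2: "unit_power m (phi x - phi y)" if "x \<in> V" "y \<in> V" "x \<noteq> y" "x \<noteq> 1" "y \<noteq> 1" for x y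
    unfolding phi_diff[OF that(4,5)]
    using that assms by (intro unit_power_divide unit_power_mult unit_power_2 V) auto
  have "phi 1 = (1::'a)" by (simp add: phi_def)
  thus ?thesis
    using 1 2 unit_power_diff_commute unfolding clique_iff by (metis imageE)
qed

section \<open>The line \<open>line K 0 \<alpha>\<close> and the \<open>m\<close>-ary lines through
  \<open>1\<close>\<close>

lemma alpha_nonzero: "\<alpha> \<noteq> 0"
  using \<alpha>_notin K_subfield by (auto simp: is_subfield_def)

text \<open>The square of \<open>\<alpha>\<close> is fixed by the \<open>q\<close>-th power, so
  \<open>\<alpha>\<close> goes to itself or its negative; the first would put it in
  \<open>K\<close>.\<close>

lemma alpha_power_q: "\<alpha> ^ q = - \<alpha>"
proof -
  have "(\<alpha> ^ q) ^ 2 = \<alpha> ^ 2" using \<alpha>_sq by (simp add: mem_K_iff mult.commute flip: power_mult)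
  hence "\<alpha> ^ q = \<alpha> \<or> \<alpha> ^ q = - \<alpha>" by (simp add: power2_eq_iff)
  thus ?thesis using \<alpha>_notin by (simp add: mem_K_iff)
qed

lemma alpha_line_iff: "z \<in> line K 0 \<alpha> \<longleftrightarrow> z ^ q = - z"
proof
  assume "z \<in> line K 0 \<alpha>"
  thus "z ^ q = - z"
    by (auto simp: line_def power_mult_distrib alpha_power_q mem_K_iff)
next
  assume "z ^ q = - z"
  hence "z / \<alpha> \<in> K" by (simp add: mem_K_iff power_divide alpha_power_q)
  moreover have "z = 0 + z / \<alpha> * \<alpha>" using alpha_nonzero by simp
  ultimately show "z \<in> line K 0 \<alpha>" unfolding line_def by blast
qed

lemma one_notin_alpha_line: "1 \<notin> line K 0 \<alpha>"
proof -
  have "(1::'a) \<noteq> - 1" using two_nonzero by (metis one_add_one add.right_inverse)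
  thus ?thesis by (simp add: alpha_line_iff)
qed

lemma K_closed:
  "x \<in> K \<Longrightarrow> y \<in> K \<Longrightarrow> x + y \<in> K" "x \<in> K \<Longrightarrow> y \<in> K \<Longrightarrow> x * y \<in> K"
  "x \<in> K \<Longrightarrow> y \<in> K \<Longrightarrow> x - y \<in> K" "0 \<in> K" "1 \<in> K"
  using K_subfield unfolding is_subfield_def
  by (auto simp: diff_conv_add_uminus simp del: add_uminus_conv_diff)

text \<open>Points of a line differ by \<open>K\<close>-multiples of its slope, and nonzero elements
  of \<open>K\<close> are \<open>m\<close>-th powers, so \<open>z - 1\<close> may serve as the
  slope.\<close>

lemma m_ary_intersections:
  "{z. \<exists>L. m_ary_line K m L \<and> 1 \<in> L \<and> L \<noteq> line K 1 \<alpha> \<and> z \<in> L \<inter> line K 0 \<alpha>} =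
   {z \<in> line K 0 \<alpha>. unit_power m (z - 1)}" (is "?Z = ?W")
proof (intro equalityI subsetI)
  fix z assume "z \<in> ?Z"
  then obtain a s where s: "unit_power m s" and 1: "1 \<in> line K a s" and zL: "z \<in> line K a s"
    and z: "z \<in> line K 0 \<alpha>"
    unfolding m_ary_line_def by auto
  from 1 zL obtain k l where kl: "k \<in> K" "l \<in> K" "1 = a + k * s" "z = a + l * s"
    unfolding line_def by blast
  hence eq: "z - 1 = (l - k) * s" by (simp add: algebra_simps)
  moreover have "z \<noteq> 1" using z one_notin_alpha_line by auto
  ultimately have "l - k \<noteq> 0" by auto
  hence "unit_power m (z - 1)"
    unfolding eq using kl s K_closed by (intro unit_power_mult[OF unit_power_K]) auto
  thus "z \<in> ?W" using z by simp
next
  fix z assume "z \<in> ?W"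
  hence z: "z \<in> line K 0 \<alpha>" and P: "unit_power m (z - 1)" by auto
  have z1: "z \<noteq> 1" using z one_notin_alpha_line by auto
  let ?L = "line K 1 (z - 1)"
  have "m_ary_line K m ?L" unfolding m_ary_line_def
    using P z1 by (intro exI[of _ 1] exI[of _ "z - 1"]) simp
  moreover have "1 \<in> ?L" "z \<in> ?L" unfolding line_def using K_closed by force+
  \<comment> \<open>The excluded line is parallel to \<open>line K 0 \<alpha>\<close>, hence cannot
    contain \<open>z\<close> and differs from \<open>?L\<close>.\<close>
  moreover have "z \<notin> line K 1 \<alpha>"
  proof
    assume "z \<in> line K 1 \<alpha>"
    then obtain k where k: "k \<in> K" "z = 1 + k * \<alpha>" unfolding line_def by blast
    obtain l where l: "l \<in> K" "z = l * \<alpha>" using z unfolding line_def by auto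
    have "1 = 0 + (l - k) * \<alpha>" using k l by (simp add: algebra_simps)
    hence "1 \<in> line K 0 \<alpha>" unfolding line_def using K_closed k l by blast
    thus False using one_notin_alpha_line by simp
  qed
  ultimately show "z \<in> ?Z" using z by blast
qed

lemma phi_Q0:
  "phi ` (Q0 q m \<beta> - {1}) = {z \<in> line K 0 \<alpha>. unit_power m (z - 1)}" (is "?A = ?W")
proof (intro equalityI subsetI)
  fix z assume "z \<in> ?A"
  then obtain u where u: "u \<in> Q0 q m \<beta>" "u \<noteq> 1" "z = phi u" by auto
  have u0: "u \<noteq> 0" using u by auto
  have "(u - 1) ^ q = inverse u - 1" "(u + 1) ^ q = inverse u + 1"
    using power_add_q[of u "- 1"] power_add_q[of u 1] u q_odd by (simp_all add: Q0_power_q)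
  hence "z ^ q = (inverse u + 1) / (inverse u - 1)" using u by (simp add: phi_def power_divide)
  also have "\<dots> = - z" using u u0 by (simp add: phi_def divide_simps) (simp add: algebra_simps)
  finally have "z \<in> line K 0 \<alpha>" by (simp add: alpha_line_iff)
  moreover have "unit_power m (z - 1)"
    unfolding u(3) phi_diff_one[OF u(2)]
    using u by (intro unit_power_divide unit_power_2 unit_power_Q0_diff_one)
  ultimately show "z \<in> ?W" by simp
next
  fix z assume "z \<in> ?W"
  hence z: "z \<in> line K 0 \<alpha>" and P: "unit_power m (z - 1)" by auto
  have z1: "z \<noteq> 1" using z one_notin_alpha_line by auto
  have "(z - 1) ^ q = - (z + 1)"
    using power_add_q[of z "- 1"] z q_odd by (simp add: alpha_line_iff)
  \<comment> \<open>The numerator \<open>z + 1\<close> of \<open>phi z\<close> is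
    \<open>- ((z - 1) ^ q)\<close>.\<close>
  hence "phi z = - ((z - 1) ^ (q - 1))"
    using z1 by (simp add: power_q_minus_1 phi_def divide_simps)
  hence "phi z \<in> Q0 q m \<beta>" using P by (simp add: unit_power_iff_Q0)
  \<comment> \<open>An involution fixing \<open>1\<close> sends nothing else to
    \<open>1\<close>.\<close>
  moreover have "phi z \<noteq> 1"
    using z1 phi_involution[OF two_nonzero, of z] by (auto simp: phi_def)
  ultimately show "z \<in> ?A"
    using phi_involution[OF two_nonzero, of z] by (metis DiffI imageI singletonD)
qed

end

theorem theorem4p16:
  fixes q m :: nat and K :: "'a::finite_field set" and d \<alpha> \<beta> :: 'a
  assumes "primepow q" and "odd q"
    and "m > 1" and "m dvd (q + 1) div 2"
    and "card (UNIV :: 'a set) = q ^ 2"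
    and "is_subfield K" and "card K = q"
    and "d \<in> K" and "d \<noteq> 0" and "\<not> (\<exists>x\<in>K. d = x ^ 2)" and "\<alpha> ^ 2 = d"
    and "primitive_element \<beta>"
  shows "clique ({0} \<union> Q0 q m \<beta>) (GP_edges m) \<and>
    (\<exists>c :: nat \<Rightarrow> 'a.
       (\<forall>i\<in>{1..(q + 1 - m) div m}. c i \<in> K) \<and>
       inj_on c {1..(q + 1 - m) div m} \<and>
       (\<lambda>i. c i * \<alpha>) ` {1..(q + 1 - m) div m} =
         {z. \<exists>L. m_ary_line K m L \<and> 1 \<in> L \<and> L \<noteq> line K 1 \<alpha> \<and> z \<in> L \<inter> line K 0 \<alpha>} \<and>
       phi ` ({0} \<union> Q0 q m \<beta>) = {1, - 1} \<union> (\<lambda>i. c i * \<alpha>) ` {1..(q + 1 - m) div m} \<and>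
       clique ({1, - 1} \<union> (\<lambda>i. c i * \<alpha>) ` {1..(q + 1 - m) div m}) (GP_edges m) \<and>
       card ({1, - 1} \<union> (\<lambda>i. c i * \<alpha>) ` {1..(q + 1 - m) div m}) = (q + 1 + m) div m)"
proof -
  obtain t where t: "(q + 1) div 2 = m * t" using \<open>m dvd (q + 1) div 2\<close> by (auto simp: dvd_def)
  define n where "n = 2 * t"
  have n: "q + 1 = m * n" "even n"
    using t \<open>odd q\<close> by (auto simp: n_def elim!: oddE)
  \<comment> \<open>If \<open>\<alpha>\<close> were in \<open>K\<close>, then \<open>d\<close> would
    be a square there.\<close>
  interpret odd_quadratic_extension q m n K \<alpha> \<beta>
    using assms n by unfold_locales auto
  let ?Q = "Q0 q m \<beta>" and ?I = "{1..(q + 1 - m) div m}"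
  let ?W = "{z \<in> line K 0 \<alpha>. unit_power m (z - 1)}"
  have len: "(q + 1 - m) div m = n - 1" "(q + 1 + m) div m = n + 1"
    using n m_pos n_pos by (cases n; simp add: algebra_simps)+
  have inj: "inj (phi :: 'a \<Rightarrow> 'a)" using phi_involution[OF two_nonzero] by (metis injI)
  \<comment> \<open>These are the coordinates of the intersection points along
    \<open>\<alpha>\<close>; \<open>c\<close> will enumerate them, their number coming from
    \<open>phi_Q0\<close>.\<close>
  define S where "S = (\<lambda>z. z / \<alpha>) ` ?W"
  have inj_S: "inj_on (\<lambda>z. z / \<alpha>) ?W" using alpha_nonzero by (auto intro: inj_onI)
  have "card ?W = card (?Q - {1})"
    unfolding phi_Q0[symmetric] by (rule card_image[OF inj_on_subset[OF inj subset_UNIV]])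
  also have "\<dots> = n - 1" by (simp add: card_Diff_singleton card_Q0)
  finally have "card S = n - 1" unfolding S_def using card_image[OF inj_S] by simp
  then obtain c where "bij_betw c {1..n - 1} S"
    using ex_bij_betw_nat_finite_1[of S] by auto
  hence c: "inj_on c ?I" "c ` ?I = S" unfolding len bij_betw_def by blast+
  have SK: "S \<subseteq> K" using alpha_nonzero by (auto simp: S_def line_def)
  have "(\<lambda>i. c i * \<alpha>) ` ?I = (\<lambda>x. x * \<alpha>) ` S" unfolding c(2)[symmetric] by (simp add: image_image)
  also have "\<dots> = ?W" using alpha_nonzero by (simp add: S_def image_image)
  finally have cW: "(\<lambda>i. c i * \<alpha>) ` ?I = ?W" .
  \<comment> \<open>The points \<open>1\<close> and \<open>- 1\<close> are the images of
    \<open>1\<close> and \<open>0\<close>; the other \<open>n - 1\<close> elements of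
    \<open>Q0\<close> go to the line.\<close>
  have "{0} \<union> ?Q = {0, 1} \<union> (?Q - {1})" by auto
  hence "phi ` ({0} \<union> ?Q) = phi ` {0, 1} \<union> phi ` (?Q - {1})" by (metis image_Un)
  also have "phi ` {0, 1} = {1, - 1 :: 'a}" by (auto simp: phi_def)
  finally have im: "phi ` ({0} \<union> ?Q) = {1, - 1} \<union> (\<lambda>i. c i * \<alpha>) ` ?I"
    by (simp only: phi_Q0 cW)
  \<comment> \<open>Counting through the injective \<open>phi\<close> avoids checking that
    \<open>1\<close>, \<open>- 1\<close> and the points on the line are distinct.\<close>
  have "card (phi ` ({0} \<union> ?Q)) = card ({0} \<union> ?Q)"
    by (rule card_image[OF inj_on_subset[OF inj subset_UNIV]])
  also have "\<dots> = n + 1" using card_Q0 by simp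
  finally have card: "card ({1, - 1} \<union> (\<lambda>i. c i * \<alpha>) ` ?I) = (q + 1 + m) div m"
    using im len by simp
  have cl: "clique ({1, - 1} \<union> (\<lambda>i. c i * \<alpha>) ` ?I) (GP_edges m)"
    unfolding im[symmetric] using clique_Q0 by (intro clique_phi_image) auto
  show ?thesis
    unfolding m_ary_intersections
    using clique_Q0 c SK cW im cl card by (intro conjI exI[of _ c]) blast+
qed

end
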